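(* Let $\mathcal{H}$ be a separable complex Hilbert space. Let $E=(E_{n,k})_{n,k\ge1}$ be an invertible infinite complex matrix, and let $m=\{m_k\}_{k=1}^\infty$ be a positive (resp. negative) and semi-normalized sequence such that $m_nE_{n,k}=E_{n,k}m_k$ for all $n,k\in\mathbb{N}$. Let $\Phi=\{\phi_k\}_{k=1}^\infty$ be an $E$-frame for $\mathcal{H}$ and let $\Psi=\{\psi_k\}_{k=1}^\infty$ be a sequence in $\mathcal{H}$ such that $\psi_k=U\phi_k$ for all $k\in\mathbb{N}$, where $U:\mathcal{H}\to\mathcal{H}$ is a bounded linear bijection. Then $\Psi$ is an $E$-frame, $M^{E}_{m,\Phi,\Psi}$ and $M^{E}_{m,\Psi,\Phi}$ are invertible, and $$\left(M^{E}_{m,\Phi,\Psi}\right)^{-1}=\begin{cases}(U^{-1})^{*}S_{E\{\sqrt{m_k}\phi_k\}}^{-1}& \text{if } m_k>0\ \forall k,\\ -(U^{-1})^{*}S_{E\{\sqrt{|m_k|}\phi_k\}}^{-1}& \text{if } m_k<0\ \forall k,\end{cases}$$ $$\left(M^{E}_{m,\Psi,\Phi}\right)^{-1}=\begin{cases}S_{E\{\sqrt{m_k}\phi_k\}}^{-1}U^{-1}& \text{if } m_k>0\ \forall k,\\ -S_{E\{\sqrt{|m_k|}\phi_k\}}^{-1}U^{-1}& \text{if } m_k<0\ \forall k.\end{cases}$$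
   Context: An infinite complex matrix $E$ is invertible if there is an infinite complex matrix $E^{-1}$ with $EE^{-1}=E^{-1}E=I$ (all entrywise sums converging). For a sequence $\{\psi_k\}$ in $\mathcal{H}$ write $E\{\psi_k\}_{k=1}^\infty=\{\sum_{k=1}^\infty E_{n,k}\psi_k\}_{n=1}^\infty$, with $n$-th term $(E\{\psi_k\}_{k=1}^\infty)_n$. $\{\psi_k\}$ is an $E$-frame for $\mathcal{H}$ if all these series converge in $\mathcal{H}$ and there are $0<A\le B<\infty$ with $A\|f\|^2\le\sum_{n=1}^\infty|\langle f,(E\{\psi_k\}_{k=1}^\infty)_n\rangle|^2\le B\|f\|^2$ for all $f\in\mathcal{H}$. (It is not required that $E$ define a mapping on $\bigoplus_{n=1}^\infty\mathcal{H}$.) The $E$-frame operator of an $E$-frame $\{\psi_k\}$ is $S_{E\{\psi_k\}}f=\sum_{n=1}^\infty\langle f,(E\{\psi_k\}_{k=1}^\infty)_n\rangle(E\{\psi_k\}_{k=1}^\infty)_n$. Under the hypotheses of the claim, $\{\sqrt{|m_k|}\,\phi_k\}_{k=1}^\infty$ is an $E$-frame, and the $E$-frame operator of an $E$-frame is invertible. The $E$-multiplier of $\Psi=\{\psi_k\}$ and $\Phi=\{\phi_k\}$ with symbol $m$ is $M^{E}_{m,\Psi,\Phi}f=\sum_{n=1}^\infty m_n\langle f,(E\{\phi_k\}_{k=1}^\infty)_n\rangle(E\{\psi_k\}_{k=1}^\infty)_n$; thus in $M^{E}_{m,\Phi,\Psi}$ the analysis is done with $\Psi$ and the synthesis with $\Phi$.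 A scalar sequence $m$ is semi-normalized if $0<\inf_n|m_n|\le\sup_n|m_n|<\infty$; positive (negative) means $m_k>0$ ($m_k<0$) for all $k$. *)

theory Defs
  imports "HOL-Analysis.Analysis"
begin

class complex_vector = real_vector +
  fixes scaleC :: "complex \<Rightarrow> 'a \<Rightarrow> 'a"  (infixr \<open>*\<^sub>C\<close> 75)
  assumes scaleC_add_right: "a *\<^sub>C (x + y) = a *\<^sub>C x + a *\<^sub>C y"
    and scaleC_add_left: "(a + b) *\<^sub>C x = a *\<^sub>C x + b *\<^sub>C x"
    and scaleC_scaleC: "a *\<^sub>C (b *\<^sub>C x) = (a * b) *\<^sub>C x"
    and scaleR_scaleC: "r *\<^sub>R x = complex_of_real r *\<^sub>C x"

(* The inner product is linear in the first argument and conjugate-linear in the second. *)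
class complex_inner = complex_vector + real_normed_vector +
  fixes cinner :: "'a \<Rightarrow> 'a \<Rightarrow> complex"
  assumes cinner_commute: "cinner x y = cnj (cinner y x)"
    and cinner_add_left: "cinner (x + y) z = cinner x z + cinner y z"
    and cinner_scaleC_left: "cinner (a *\<^sub>C x) y = a * cinner x y"
    and cinner_ge_zero: "0 \<le> Re (cinner x x)"
    and cinner_eq_zero_iff: "cinner x x = 0 \<longleftrightarrow> x = 0"
    and norm_eq_sqrt_cinner: "norm x = sqrt (Re (cinner x x))"

class chilbert_space = complex_inner + complete_space

instantiation complex :: chilbert_space
begin

definition scaleC_complex :: "complex \<Rightarrow> complex \<Rightarrow> complex"
  where "scaleC_complex a x = a * x"

definition cinner_complex :: "complex \<Rightarrow> complex \<Rightarrow> complex"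
  where "cinner_complex x y = x * cnj y"

instance
proof
  fix x y z a b :: complex and r :: real
  show "a *\<^sub>C (x + y) = a *\<^sub>C x + a *\<^sub>C y" "(a + b) *\<^sub>C x = a *\<^sub>C x + b *\<^sub>C x"
    "a *\<^sub>C (b *\<^sub>C x) = (a * b) *\<^sub>C x"
    by (simp_all add: scaleC_complex_def algebra_simps)
  show "r *\<^sub>R x = complex_of_real r *\<^sub>C x"
    by (simp add: scaleC_complex_def scaleR_conv_of_real)
  show "cinner x y = cnj (cinner y x)" "cinner (x + y) z = cinner x z + cinner y z"
    "cinner (a *\<^sub>C x) y = a * cinner x y" "cinner x x = 0 \<longleftrightarrow> x = 0"
    by (simp_all add: cinner_complex_def scaleC_complex_def algebra_simps)
  show "0 \<le> Re (cinner x x)" "norm x = sqrt (Re (cinner x x))"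
    by (simp_all add: cinner_complex_def cmod_def power2_eq_square)
qed

end

definition bounded_clinear :: "('a::complex_inner \<Rightarrow> 'b::complex_inner) \<Rightarrow> bool"
  where "bounded_clinear T \<longleftrightarrow> bounded_linear T \<and> (\<forall>c x. T (c *\<^sub>C x) = c *\<^sub>C T x)"

definition invertible_operator :: "('a::complex_inner \<Rightarrow> 'a) \<Rightarrow> bool"
  where "invertible_operator T \<longleftrightarrow> bounded_clinear T \<and> bij T \<and> bounded_clinear (inv T)"

(* Exists and is unique for bounded operators on a Hilbert space. *)
definition cadjoint :: "('a::complex_inner \<Rightarrow> 'a) \<Rightarrow> 'a \<Rightarrow> 'a"
  where "cadjoint T = (SOME T'. \<forall>x y. cinner (T x) y = cinner x (T' y))"

(* Infinite matrices and sequences are indexed from 0. *)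
type_synonym infinite_matrix = "nat \<Rightarrow> nat \<Rightarrow> complex"

definition is_identity_product :: "infinite_matrix \<Rightarrow> infinite_matrix \<Rightarrow> bool"
  where "is_identity_product E F \<longleftrightarrow>
    (\<forall>n j. (\<lambda>k. E n k * F k j) sums (if n = j then 1 else 0))"

definition invertible_infinite_matrix :: "infinite_matrix \<Rightarrow> bool"
  where "invertible_infinite_matrix E \<longleftrightarrow>
    (\<exists>F. is_identity_product E F \<and> is_identity_product F E)"

definition matrix_seq :: "infinite_matrix \<Rightarrow> (nat \<Rightarrow> 'a::complex_inner) \<Rightarrow> nat \<Rightarrow> 'a"
  where "matrix_seq E \<psi> n = (\<Sum>k. E n k *\<^sub>C \<psi> k)"

definition is_E_frame :: "infinite_matrix \<Rightarrow> (nat \<Rightarrow> 'a::complex_inner) \<Rightarrow> bool"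
  where "is_E_frame E \<psi> \<longleftrightarrow>
    (\<forall>n. summable (\<lambda>k. E n k *\<^sub>C \<psi> k)) \<and>
    (\<exists>A B. 0 < A \<and> A \<le> B \<and>
      (\<forall>f. summable (\<lambda>n. (cmod (cinner f (matrix_seq E \<psi> n)))\<^sup>2) \<and>
           A * (norm f)\<^sup>2 \<le> (\<Sum>n. (cmod (cinner f (matrix_seq E \<psi> n)))\<^sup>2) \<and>
           (\<Sum>n. (cmod (cinner f (matrix_seq E \<psi> n)))\<^sup>2) \<le> B * (norm f)\<^sup>2))"

(* Since suminf is total, convergence of the series defining the operators below is expressed
   by the separate predicates E_frame_operator_converges and E_multiplier_converges. *)
definition E_frame_operator :: "infinite_matrix \<Rightarrow> (nat \<Rightarrow> 'a::complex_inner) \<Rightarrow> 'a \<Rightarrow> 'a"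
  where "E_frame_operator E \<psi> f =
    (\<Sum>n. cinner f (matrix_seq E \<psi> n) *\<^sub>C matrix_seq E \<psi> n)"

definition E_frame_operator_converges :: "infinite_matrix \<Rightarrow> (nat \<Rightarrow> 'a::complex_inner) \<Rightarrow> bool"
  where "E_frame_operator_converges E \<psi> \<longleftrightarrow>
    (\<forall>f. summable (\<lambda>n. cinner f (matrix_seq E \<psi> n) *\<^sub>C matrix_seq E \<psi> n))"

(* Synthesis with the first sequence, analysis with the second. *)
definition E_multiplier ::
  "infinite_matrix \<Rightarrow> (nat \<Rightarrow> complex) \<Rightarrow> (nat \<Rightarrow> 'a::complex_inner) \<Rightarrow> (nat \<Rightarrow> 'a) \<Rightarrow> 'a \<Rightarrow> 'a"
  where "E_multiplier E m \<psi> \<phi> f =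
    (\<Sum>n. (m n * cinner f (matrix_seq E \<phi> n)) *\<^sub>C matrix_seq E \<psi> n)"

definition E_multiplier_converges ::
  "infinite_matrix \<Rightarrow> (nat \<Rightarrow> complex) \<Rightarrow> (nat \<Rightarrow> 'a::complex_inner) \<Rightarrow> (nat \<Rightarrow> 'a) \<Rightarrow> bool"
  where "E_multiplier_converges E m \<psi> \<phi> \<longleftrightarrow>
    (\<forall>f. summable (\<lambda>n. (m n * cinner f (matrix_seq E \<phi> n)) *\<^sub>C matrix_seq E \<psi> n))"

(* In the reals SUP is meaningful only for bounded sets, so a finite supremum is bdd_above. *)
definition semi_normalized :: "(nat \<Rightarrow> 'a::real_normed_vector) \<Rightarrow> bool"
  where "semi_normalized m \<longleftrightarrow> 0 < (INF n. norm (m n)) \<and> bdd_above (range (\<lambda>n. norm (m n)))"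

end

theory Submission
  imports Defs
begin

text \<open>
  Write \<open>g\<^sub>n = (E\<phi>)\<^sub>n\<close>, so that \<open>g\<close> is an ordinary frame. The relation between \<open>m\<close> and \<open>E\<close> says
  that \<open>m\<^sub>k = m\<^sub>n\<close> wherever \<open>E\<^sub>n\<^sub>k \<noteq> 0\<close>; hence a weight that is a function of \<open>m\<^sub>k\<close> can be pulled out
  of the series for \<open>(E\<phi>)\<^sub>n\<close>, and the sequence \<open>\<surd>\<bar>m\<^sub>k\<bar> \<phi>\<^sub>k\<close> is transformed by \<open>E\<close> into
  \<open>\<surd>\<bar>m\<^sub>n\<bar> g\<^sub>n\<close> (\<open>matrix_seq_weighted\<close>). Likewise continuity of \<open>U\<close> gives \<open>(E\<psi>)\<^sub>n = U g\<^sub>n\<close>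
  (\<open>matrix_seq_image\<close>). With \<open>\<epsilon>\<close> the common sign of the \<open>m\<^sub>n\<close> and \<open>S\<close> the frame operator of
  \<open>\<surd>\<bar>m\<^sub>n\<bar> g\<^sub>n\<close>, moving \<open>U\<close> across the inner product turns the multipliers into \<open>\<epsilon> S U\<^sup>*\<close> and
  \<open>\<epsilon> U S\<close> (\<open>sums_weighted_multiplier\<close>), and the formulas for the inverses can be read off, because
  \<open>(U\<^sup>*)\<^sup>-\<^sup>1 = (U\<^sup>-\<^sup>1)\<^sup>*\<close>.

  What remains is functional analysis. Three facts carry it.

  A bounded coercive operator is invertible, by the contraction principle
  (\<open>invertible_operator_coercive\<close>). The lower frame bound is exactly coercivity of \<open>S\<close>.

  Every bounded operator on a space with a frame has an adjoint (\<open>adjoint_exists\<close>). The frame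
  itself provides it, in place of the Riesz representation theorem: each vector has an expansion \<open>\<Sum>\<^sub>n \<langle>w, g\<^sub>n\<rangle> g\<^sub>n\<close> because the frame
  operator is onto, and applying \<open>T\<close> termwise shows what \<open>T\<^sup>*\<close> must be.

  A bounded bijection has a bounded inverse (\<open>invertible_operatorI_bij\<close>). Surjectivity of \<open>T\<close> makes
  the set \<open>{y. \<parallel>T\<^sup>* y\<parallel> \<le> 1}\<close> weakly bounded, hence bounded by uniform boundedness; so \<open>T\<^sup>*\<close> is bounded
  below, \<open>T T\<^sup>*\<close> is coercive, and \<open>T\<^sup>* (T T\<^sup>*)\<^sup>-\<^sup>1\<close> is the inverse.
\<close>

section \<open>Complex inner product spaces\<close>

instance chilbert_space \<subseteq> banach ..

lemma cinner_add_right: "cinner x (y + z) = cinner x y + cinner x z"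
  by (metis cinner_commute cinner_add_left complex_cnj_add)

lemma cinner_scaleC_right: "cinner x (a *\<^sub>C y) = cnj a * cinner x y"
  by (metis cinner_commute cinner_scaleC_left complex_cnj_mult)

lemma cinner_scaleR_left: "cinner (r *\<^sub>R x) y = r * cinner x y"
  by (simp add: scaleR_scaleC cinner_scaleC_left)

lemma cinner_scaleR_right: "cinner x (r *\<^sub>R y) = r * cinner x y"
  by (simp add: scaleR_scaleC cinner_scaleC_right)

lemma cinner_zero_right [simp]: "cinner x 0 = 0"
  using cinner_scaleR_right[of _ 0] by simp

lemma cinner_minus_left: "cinner (- x) y = - cinner x y"
  using cinner_scaleR_left[of "-1" x y] by simp

lemma cinner_minus_right: "cinner x (- y) = - cinner x y"
  using cinner_scaleR_right[of x "-1" y] by simp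

lemma cinner_diff_left: "cinner (x - y) z = cinner x z - cinner y z"
  using cinner_add_left[of x "- y" z] by (simp add: cinner_minus_left)

lemma cinner_diff_right: "cinner x (y - z) = cinner x y - cinner x z"
  using cinner_add_right[of x y "- z"] by (simp add: cinner_minus_right)

lemma Re_cinner_self: "Re (cinner x x) = (norm x)\<^sup>2"
  by (simp add: norm_eq_sqrt_cinner cinner_ge_zero)

lemma cinner_self: "cinner x x = complex_of_real ((norm x)\<^sup>2)"
proof (rule complex_eqI)
  show "Im (cinner x x) = Im (complex_of_real ((norm x)\<^sup>2))"
    using arg_cong[OF cinner_commute[of x x], of Im] by simp
qed (simp add: Re_cinner_self)

lemma cmod_cinner_commute: "cmod (cinner x y) = cmod (cinner y x)"
  by (metis cinner_commute complex_mod_cnj)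

lemma cinner_mult_commute: "cinner x y * cinner y x = complex_of_real ((cmod (cinner x y))\<^sup>2)"
  by (metis cinner_commute complex_norm_square)

lemma norm_scaleC: "norm (a *\<^sub>C x) = cmod a * norm (x::'a::complex_inner)"
proof -
  have "(norm (a *\<^sub>C x))\<^sup>2 = Re (a * cnj a * cinner x x)"
    by (simp add: Re_cinner_self[symmetric] cinner_scaleC_left cinner_scaleC_right mult_ac)
  also have "\<dots> = (cmod a * norm x)\<^sup>2"
    by (simp add: cinner_self complex_norm_square[symmetric] power_mult_distrib
        del: of_real_power flip: of_real_mult)
  finally show ?thesis
    by (simp add: power2_eq_iff_nonneg)
qed

text \<open>
  Multiplying the component of \<open>x\<close> orthogonal to \<open>y\<close> by \<open>\<parallel>y\<parallel>\<^sup>2\<close> avoids a division; the squared norm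
  of the resulting vector is \<open>\<parallel>y\<parallel>\<^sup>2\<close> times the difference of the squares of the two sides.
\<close>

lemma cinner_Cauchy_Schwarz: "cmod (cinner x y) \<le> norm x * norm y"
proof (cases "y = 0")
  case False
  define N where "N = (norm y)\<^sup>2"
  have N: "N > 0"
    using False by (simp add: N_def)
  have "0 \<le> (norm (N *\<^sub>R x - cinner x y *\<^sub>C y))\<^sup>2"
    by simp
  also have "\<dots> = N * (N * (norm x)\<^sup>2 - (cmod (cinner x y))\<^sup>2)"
  proof -
    have "cinner (N *\<^sub>R x - cinner x y *\<^sub>C y) (N *\<^sub>R x - cinner x y *\<^sub>C y)
        = N * N * cinner x x - N * (cinner x y * cnj (cinner x y))
          - N * (cinner x y * cinner y x) + cinner x y * cnj (cinner x y) * cinner y y"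
      by (simp add: cinner_diff_left cinner_diff_right cinner_scaleR_left cinner_scaleR_right
          cinner_scaleC_left cinner_scaleC_right algebra_simps)
    also have "\<dots> = complex_of_real (N * (N * (norm x)\<^sup>2 - (cmod (cinner x y))\<^sup>2))"
      unfolding cinner_mult_commute complex_norm_square[symmetric] cinner_self[of x]
        cinner_self[of y] N_def[symmetric]
      by (simp add: algebra_simps)
    finally show ?thesis
      by (metis Re_cinner_self Re_complex_of_real)
  qed
  finally have "(cmod (cinner x y))\<^sup>2 \<le> (norm x * norm y)\<^sup>2"
    using N by (simp add: zero_le_mult_iff power_mult_distrib N_def mult.commute)
  then show ?thesis
    by (rule power2_le_imp_le) simp
qed simp

lemma bounded_linear_cinner_left: "bounded_linear (\<lambda>x. cinner x y)"
  by (rule bounded_linear_intro[where K = "norm y"])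
    (simp_all add: cinner_add_left cinner_scaleR_left scaleR_conv_of_real cinner_Cauchy_Schwarz)

lemma bounded_linear_cinner_right: "bounded_linear (cinner x)"
  by (rule bounded_linear_intro[where K = "norm x"])
    (simp_all add: cinner_add_right cinner_scaleR_right scaleR_conv_of_real
      cinner_Cauchy_Schwarz mult.commute[of "norm _" "norm x"])

lemma bounded_linear_scaleC: "bounded_linear (\<lambda>x::'a::complex_inner. a *\<^sub>C x)"
  by (rule bounded_linear_intro[where K = "cmod a"])
    (simp_all add: scaleC_add_right scaleR_scaleC scaleC_scaleC norm_scaleC mult.commute)

lemma eq_if_cinner_eq:
  assumes "\<And>x. cinner x y = cinner x z"
  shows "y = z"
  using assms[of "y - z"] cinner_eq_zero_iff[of "y - z"] by (simp add: cinner_diff_right)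

section \<open>Bounded operators and adjoints\<close>

lemma bounded_clinearI:
  assumes "\<And>x y. T (x + y) = T x + T y" "\<And>c x. T (c *\<^sub>C x) = c *\<^sub>C T x"
    and "\<And>x. norm (T x) \<le> norm x * K"
  shows "bounded_clinear T"
  unfolding bounded_clinear_def
  using assms by (auto intro!: bounded_linear_intro[where K = K] simp: scaleR_scaleC)

lemma bounded_clinear_bounded_linear: "bounded_clinear T \<Longrightarrow> bounded_linear T"
  by (simp add: bounded_clinear_def)

lemma bounded_clinear_scaleC: "bounded_clinear T \<Longrightarrow> T (c *\<^sub>C x) = c *\<^sub>C T x"
  by (simp add: bounded_clinear_def)

lemma bounded_clinear_compose:
  "bounded_clinear S \<Longrightarrow> bounded_clinear T \<Longrightarrow> bounded_clinear (S \<circ> T)"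
  unfolding bounded_clinear_def by (auto intro: bounded_linear_compose simp: o_def)

lemma invertible_operator_compose:
  assumes "invertible_operator S" "invertible_operator T"
  shows "invertible_operator (S \<circ> T)"
  using assms unfolding invertible_operator_def
  by (auto simp: o_inv_distrib bij_comp intro: bounded_clinear_compose)

lemma invertible_operator_uminus:
  assumes "invertible_operator T"
  shows "invertible_operator (\<lambda>x. - T x)" "inv (\<lambda>x. - T x) = (\<lambda>x. - inv T x)"
proof -
  have T: "bounded_clinear T" "bij T" "bounded_clinear (inv T)"
    using assms by (auto simp: invertible_operator_def)
  have neg: "bounded_clinear (\<lambda>x. - S x)" if "bounded_clinear S" for S :: "'a \<Rightarrow> 'a"
    using that linear_neg[OF bounded_linear.linear[OF bounded_linear_scaleC]]
    unfolding bounded_clinear_def by (metis bounded_linear_minus)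
  have T_minus: "T (- x) = - T x" for x
    using T(1) by (simp add: bounded_clinear_def bounded_linear.linear linear_neg)
  have "- T (- inv T x) = x" "- inv T (- T x) = x" for x
    using T(2) by (simp_all add: T_minus[symmetric] bij_is_inj)
      (simp add: T_minus bij_is_surj surj_f_inv_f)
  then have *: "(\<lambda>x. - T x) \<circ> (\<lambda>x. - inv T x) = id" "(\<lambda>x. - inv T x) \<circ> (\<lambda>x. - T x) = id"
    by (simp_all add: fun_eq_iff)
  show inv: "inv (\<lambda>x. - T x) = (\<lambda>x. - inv T x)"
    using * by (intro inv_unique_comp)
  have "bij (\<lambda>x. - T x)"
    using * by (rule o_bij[rotated])
  with neg T show "invertible_operator (\<lambda>x. - T x)"
    by (simp add: invertible_operator_def inv)
qed

lemma invertible_operatorI_bounded_below: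
  fixes T :: "'a::complex_inner \<Rightarrow> 'a"
  assumes T: "bounded_clinear T" "surj T" and c: "0 < c" "\<And>x. c * norm x \<le> norm (T x)"
  shows "invertible_operator T"
proof -
  have lin: "linear T"
    using T(1) by (simp add: bounded_clinear_def bounded_linear.linear)
  have "inj T"
    unfolding linear_injective_0[OF lin]
  proof (intro allI impI)
    fix x assume "T x = 0"
    then show "x = 0"
      using c(1) c(2)[of x] by (simp add: mult_le_0_iff)
  qed
  with T have bij: "bij T"
    by (simp add: bij_def)
  then have eq: "T (inv T y) = y" for y
    by (simp add: bij_is_surj surj_f_inv_f)
  have "bounded_clinear (inv T)"
  proof (rule bounded_clinearI)
    show "inv T (x + y) = inv T x + inv T y" for x y
      by (metis bij eq bij_inv_eq_iff linear_add[OF lin])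
    show "inv T (a *\<^sub>C x) = a *\<^sub>C inv T x" for a x
      by (metis bij eq bij_inv_eq_iff bounded_clinear_scaleC[OF T(1)])
    show "norm (inv T x) \<le> norm x * (1 / c)" for x
      using c(1) c(2)[of "inv T x"] by (simp add: eq field_simps)
  qed
  with T bij show ?thesis
    by (simp add: invertible_operator_def)
qed

text \<open>
  The Lax-Milgram argument: solving \<open>T x = y\<close> means finding a fixed point of
  \<open>x \<mapsto> x - t (T x - y)\<close>, and coercivity makes this map a contraction for small \<open>t > 0\<close>.
\<close>

lemma invertible_operator_coercive:
  fixes T :: "'a::chilbert_space \<Rightarrow> 'a"
  assumes T: "bounded_clinear T" and c: "0 < c" "\<And>x. c * (norm x)\<^sup>2 \<le> Re (cinner (T x) x)"
  shows "invertible_operator T"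
proof (rule invertible_operatorI_bounded_below[OF T _ c(1)])
  have bl: "bounded_linear T"
    using T by (rule bounded_clinear_bounded_linear)
  show below: "c * norm x \<le> norm (T x)" for x
  proof (cases "x = 0")
    case False
    have "c * norm x * norm x \<le> norm (T x) * norm x"
      using c(2)[of x] complex_Re_le_cmod[of "cinner (T x) x"] cinner_Cauchy_Schwarz[of "T x" x]
      by (simp add: power2_eq_square mult.assoc)
    with False show ?thesis
      by simp
  qed simp
  obtain K where K: "K > 0" "\<And>x. norm (T x) \<le> norm x * K"
    using bounded_linear.pos_bounded[OF bl] by blast
  \<comment> \<open>The squared contraction factor will be \<open>1 - c\<^sup>2 / C\<^sup>2\<close>, and \<open>C > c\<close> makes it nonnegative.\<close>
  define C where "C = K + c"
  have C: "C > 0" "c < C" "norm (T x) \<le> C * norm x" for x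
    using K(1) K(2)[of x] c(1) by (auto simp: C_def algebra_simps intro: add_increasing2)
  \<comment> \<open>The minimiser of the quadratic \<open>1 - 2 c t + C\<^sup>2 t\<^sup>2\<close>, which bounds the squared factor.\<close>
  define t where "t = c / C\<^sup>2"
  have q: "0 \<le> 1 - c\<^sup>2 / C\<^sup>2" "1 - c\<^sup>2 / C\<^sup>2 < 1"
    using C(1,2) c(1) power_mono[of c C 2] by simp_all
  have contr: "norm (x - t *\<^sub>R T x) \<le> sqrt (1 - c\<^sup>2 / C\<^sup>2) * norm x" for x
  proof -
    have "(norm (x - t *\<^sub>R T x))\<^sup>2
        = Re (cinner x x) - t * Re (cinner x (T x)) - t * Re (cinner (T x) x)
          + t * t * Re (cinner (T x) (T x))"
      by (simp add: Re_cinner_self[of "x - t *\<^sub>R T x", symmetric] cinner_diff_left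
          cinner_diff_right cinner_scaleR_left cinner_scaleR_right algebra_simps)
    also have "Re (cinner x (T x)) = Re (cinner (T x) x)"
      by (subst cinner_commute) simp
    also have "Re (cinner x x) - t * Re (cinner (T x) x) - t * Re (cinner (T x) x)
          + t * t * Re (cinner (T x) (T x))
        \<le> (norm x)\<^sup>2 - t * (c * (norm x)\<^sup>2) - t * (c * (norm x)\<^sup>2) + t * t * (C * norm x)\<^sup>2"
      unfolding Re_cinner_self using c C
      by (intro add_mono diff_mono mult_left_mono power_mono) (auto simp: t_def)
    also have "\<dots> = (1 - c\<^sup>2 / C\<^sup>2) * (norm x)\<^sup>2"
      using C(1) by (simp add: t_def power_mult_distrib field_simps power2_eq_square)
    also have "\<dots> = (sqrt (1 - c\<^sup>2 / C\<^sup>2) * norm x)\<^sup>2"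
      using q by (simp add: power_mult_distrib)
    finally show ?thesis
      using q by (intro power2_le_imp_le[of "norm (x - t *\<^sub>R T x)"]) auto
  qed
  show "surj T"
  proof (rule surjI)
    fix y
    have "\<exists>!x. x - t *\<^sub>R (T x - y) = x"
    proof (rule banach_fix_type[where c = "sqrt (1 - c\<^sup>2 / C\<^sup>2)"])
      show "\<forall>x z. dist (x - t *\<^sub>R (T x - y)) (z - t *\<^sub>R (T z - y))
          \<le> sqrt (1 - c\<^sup>2 / C\<^sup>2) * dist x z"
      proof (intro allI)
        fix x z
        have "x - t *\<^sub>R (T x - y) - (z - t *\<^sub>R (T z - y)) = (x - z) - t *\<^sub>R T (x - z)"
          by (simp add: linear_diff[OF bounded_linear.linear[OF bl]] algebra_simps)
        then show "dist (x - t *\<^sub>R (T x - y)) (z - t *\<^sub>R (T z - y))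
            \<le> sqrt (1 - c\<^sup>2 / C\<^sup>2) * dist x z"
          unfolding dist_norm using contr[of "x - z"] by metis
      qed
    qed (use q in auto)
    then have "\<exists>x. T x = y"
      using c(1) C(1) by (auto simp: t_def)
    then show "T (SOME x. T x = y) = y"
      by (rule someI_ex)
  qed
qed

text \<open>
  Phrased as a relation, since an adjoint is constructed here only for operators on a space that
  has a frame; any map in this relation to \<open>T\<close> is the value of the choice in \<open>cadjoint\<close>.
\<close>

definition is_adjoint :: "('a::complex_inner \<Rightarrow> 'a) \<Rightarrow> ('a \<Rightarrow> 'a) \<Rightarrow> bool"
  where "is_adjoint T T' \<longleftrightarrow> (\<forall>x y. cinner (T x) y = cinner x (T' y))"

lemma cadjoint_eqI:
  assumes "is_adjoint T T'"
  shows "cadjoint T = T'"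
proof -
  have spec: "\<forall>x y. cinner (T x) y = cinner x (T' y)"
    using assms by (simp add: is_adjoint_def)
  have "\<forall>x y. cinner (T x) y = cinner x (cadjoint T y)"
    unfolding cadjoint_def
    by (rule someI[where P = "\<lambda>T'. \<forall>x y. cinner (T x) y = cinner x (T' y)", OF spec])
  with spec show ?thesis
    by (metis eq_if_cinner_eq ext)
qed

lemma bounded_clinear_adjoint:
  assumes T: "bounded_clinear T" and adj: "is_adjoint T T'"
  shows "bounded_clinear T'"
proof -
  obtain K where K: "K > 0" "\<And>x. norm (T x) \<le> norm x * K"
    using bounded_linear.pos_bounded[OF bounded_clinear_bounded_linear[OF T]] by blast
  have adj': "cinner x (T' y) = cinner (T x) y" for x y
    using adj by (simp add: is_adjoint_def)
  show ?thesis
  proof (rule bounded_clinearI)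
    show "T' (x + y) = T' x + T' y" "T' (c *\<^sub>C x) = c *\<^sub>C T' x" for x y c
      by (rule eq_if_cinner_eq; simp add: adj' cinner_add_right cinner_scaleC_right)+
    show "norm (T' y) \<le> norm y * K" for y
    proof (cases "T' y = 0")
      case False
      have "norm (T' y) * norm (T' y) = cmod (cinner (T' y) (T' y))"
        by (simp add: cinner_self power2_eq_square norm_mult)
      also have "\<dots> \<le> norm (T (T' y)) * norm y"
        by (simp add: adj' cinner_Cauchy_Schwarz)
      also have "\<dots> \<le> norm (T' y) * K * norm y"
        by (intro mult_right_mono K) auto
      finally show ?thesis
        using False by (simp add: mult_ac)
    qed (use K in simp)
  qed
qed

lemma invertible_operator_adjoint:
  assumes U: "invertible_operator U" and adj: "is_adjoint U U'" "is_adjoint (inv U) V'"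
  shows "invertible_operator U'" "inv U' = V'"
proof -
  have bc: "bounded_clinear U" "bij U" "bounded_clinear (inv U)"
    using U by (auto simp: invertible_operator_def)
  have a: "cinner x (U' y) = cinner (U x) y" "cinner x (V' y) = cinner (inv U x) y" for x y
    using adj by (auto simp: is_adjoint_def)
  have "U' (V' y) = y" "V' (U' y) = y" for y
    using bc(2)
    by (rule_tac eq_if_cinner_eq, simp add: a bij_is_inj bij_is_surj surj_f_inv_f)+
  then have *: "U' \<circ> V' = id" "V' \<circ> U' = id"
    by (simp_all add: fun_eq_iff)
  show inv: "inv U' = V'"
    using * by (intro inv_unique_comp)
  have "bij U'"
    using * by (rule o_bij[rotated])
  then show "invertible_operator U'"
    using bc adj by (auto simp: invertible_operator_def inv intro: bounded_clinear_adjoint)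
qed

text \<open>
  Uniform boundedness for the functionals \<open>\<langle>_, y\<rangle>\<close>: by Baire's theorem they are bounded by a common
  constant on some ball, and moving from its centre in the direction of \<open>y\<close> turns this into a bound
  on \<open>\<parallel>y\<parallel>\<close>.
\<close>

lemma weakly_bounded_imp_bounded:
  fixes Y :: "'a::chilbert_space set"
  assumes weak: "\<And>x. \<exists>K. \<forall>y\<in>Y. cmod (cinner x y) \<le> K"
  shows "\<exists>K. \<forall>y\<in>Y. norm y \<le> K"
proof -
  define C where "C n = {x. \<forall>y\<in>Y. cmod (cinner x y) \<le> real n}" for n :: nat
  have closed: "closed (C n)" for n
  proof -
    have "C n = (\<Inter>y\<in>Y. {x. cmod (cinner x y) \<le> real n})"
      by (auto simp: C_def)
    also have "closed \<dots>"
      by (intro closed_INT ballI closed_Collect_le continuous_intros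
          bounded_linear.continuous_on[OF bounded_linear_cinner_left])
    finally show ?thesis .
  qed
  have cover: "\<Union>(range C) = UNIV"
  proof (intro equalityI subset_UNIV subsetI)
    fix x
    obtain K where K: "\<forall>y\<in>Y. cmod (cinner x y) \<le> K"
      using weak by blast
    obtain n where "K \<le> real n"
      using real_arch_simple by blast
    with K have "x \<in> C n"
      unfolding C_def by fastforce
    then show "x \<in> \<Union>(range C)"
      by blast
  qed
  have "\<exists>n. interior (C n) \<noteq> {}"
  proof (rule ccontr)
    assume "\<not> ?thesis"
    then have "euclidean interior_of \<Union>(range C) = {}"
      using closed by (intro Baire_category_alt disjI1 completely_metrizable_space_euclidean) auto
    then show False
      using cover by simp
  qed
  then obtain n x0 r where r: "r > 0" "ball x0 r \<subseteq> C n"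
    by (auto simp: mem_interior)
  have "norm y \<le> 4 * real n / r" if "y \<in> Y" for y
  proof (cases "y = 0")
    case False
    define z where "z = x0 + (r / (2 * norm y)) *\<^sub>R y"
    have "z \<in> ball x0 r" "x0 \<in> ball x0 r"
      using r False by (simp_all add: z_def dist_norm)
    then have b: "cmod (cinner z y) \<le> real n" "cmod (cinner x0 y) \<le> real n"
      using subsetD[OF r(2)] that unfolding C_def by blast+
    have "cinner z y - cinner x0 y = complex_of_real (r / 2 * norm y)"
      using False by (simp add: z_def cinner_add_left cinner_scaleR_left cinner_self
          power2_eq_square)
    then have "r / 2 * norm y = cmod (cinner z y - cinner x0 y)"
      using r(1) by (simp only: norm_of_real) simp
    also have "\<dots> \<le> real n + real n"
      using b by (intro order_trans[OF norm_triangle_ineq4] add_mono)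
    finally show ?thesis
      using r(1) by (simp add: field_simps)
  qed (use r in simp)
  then show ?thesis
    by blast
qed

text \<open>
  The bounded inverse theorem. For \<open>\<parallel>T\<^sup>* y\<parallel> \<le> 1\<close> the number \<open>\<langle>x, y\<rangle> = \<langle>T\<^sup>-\<^sup>1 x, T\<^sup>* y\<rangle>\<close> is bounded in
  terms of \<open>x\<close> alone, so uniform boundedness applies to the set of all such \<open>y\<close> before continuity
  of \<open>T\<^sup>-\<^sup>1\<close> is known.
\<close>

lemma invertible_operatorI_bij:
  fixes T :: "'a::chilbert_space \<Rightarrow> 'a"
  assumes T: "bounded_clinear T" "bij T" and adj: "is_adjoint T T'"
  shows "invertible_operator T"
proof -
  have T': "bounded_clinear T'"
    using T(1) adj by (rule bounded_clinear_adjoint)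
  have adj': "cinner x (T' y) = cinner (T x) y" for x y
    using adj by (simp add: is_adjoint_def)
  have surj: "T (inv T x) = x" for x
    using T(2) by (simp add: bij_is_surj surj_f_inv_f)
  have "\<exists>K. \<forall>y\<in>{y. norm (T' y) \<le> 1}. norm y \<le> K"
  proof (rule weakly_bounded_imp_bounded)
    fix x
    have "cmod (cinner x y) \<le> norm (inv T x)" if "norm (T' y) \<le> 1" for y
    proof -
      have "cinner x y = cinner (inv T x) (T' y)"
        by (simp add: adj' surj)
      also have "cmod \<dots> \<le> norm (inv T x) * norm (T' y)"
        by (rule cinner_Cauchy_Schwarz)
      also have "\<dots> \<le> norm (inv T x)"
        using that by (simp add: mult_left_le)
      finally show ?thesis .
    qed
    then show "\<exists>K. \<forall>y\<in>{y. norm (T' y) \<le> 1}. cmod (cinner x y) \<le> K"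
      by blast
  qed
  then obtain K0 where K0: "\<And>y. norm (T' y) \<le> 1 \<Longrightarrow> norm y \<le> K0"
    by blast
  define K where "K = max K0 1"
  have K: "K > 0" "\<And>y. norm (T' y) \<le> 1 \<Longrightarrow> norm y \<le> K"
    using K0 by (auto simp: K_def le_max_iff_disj)
  have below: "norm y \<le> K * norm (T' y)" for y
  proof (cases "T' y = 0")
    case True
    have "cinner y y = cinner (inv T y) (T' y)"
      by (simp add: adj' surj)
    with True have "y = 0"
      by (simp add: cinner_eq_zero_iff)
    then show ?thesis
      using K(1) by simp
  next
    case False
    have "norm (T' ((1 / norm (T' y)) *\<^sub>R y)) \<le> 1"
      using T' False by (simp add: linear_scale[OF bounded_linear.linear]
          bounded_clinear_bounded_linear)
    then have "norm ((1 / norm (T' y)) *\<^sub>R y) \<le> K"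
      by (rule K)
    then show ?thesis
      using False by (simp add: field_simps)
  qed
  have "invertible_operator (T \<circ> T')"
  proof (rule invertible_operator_coercive)
    show "bounded_clinear (T \<circ> T')"
      using T(1) T' by (rule bounded_clinear_compose)
    show "0 < 1 / K\<^sup>2"
      using K(1) by simp
    show "1 / K\<^sup>2 * (norm y)\<^sup>2 \<le> Re (cinner ((T \<circ> T') y) y)" for y
    proof -
      have "(norm y)\<^sup>2 \<le> (K * norm (T' y))\<^sup>2"
        using below by (rule power_mono) simp
      then show ?thesis
        using K(1) by (simp add: adj'[symmetric] Re_cinner_self power_mult_distrib field_simps)
    qed
  qed
  then have inv: "bounded_clinear (T' \<circ> inv (T \<circ> T'))" "bij (T \<circ> T')"
    using T' by (auto simp: invertible_operator_def intro: bounded_clinear_compose)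
  have "T ((T' \<circ> inv (T \<circ> T')) y) = y" for y
    using surj_f_inv_f[OF bij_is_surj[OF inv(2)], of y] by simp
  then have "inv T = T' \<circ> inv (T \<circ> T')"
    using T(2) by (metis bij_inv_eq_iff ext)
  with T inv show ?thesis
    by (simp add: invertible_operator_def)
qed
section \<open>Frames\<close>

locale hilbert_frame =
  fixes g :: "nat \<Rightarrow> 'a::chilbert_space" and A B :: real
  assumes A_pos: "0 < A" and A_le_B: "A \<le> B"
    and summable_coeffs: "summable (\<lambda>n. (cmod (cinner f (g n)))\<^sup>2)"
    and lower: "A * (norm f)\<^sup>2 \<le> (\<Sum>n. (cmod (cinner f (g n)))\<^sup>2)"
    and upper: "(\<Sum>n. (cmod (cinner f (g n)))\<^sup>2) \<le> B * (norm f)\<^sup>2"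
begin

lemma B_nonneg: "0 \<le> B"
  using A_pos A_le_B by simp

text \<open>
  Duality: pairing \<open>x = \<Sum> c\<^sub>n g\<^sub>n\<close> with itself brings in the coefficients \<open>\<langle>x, g\<^sub>n\<rangle>\<close>, which the upper
  frame bound controls by \<open>\<parallel>x\<parallel>\<close>.
\<close>

lemma norm_finite_synthesis_le:
  assumes "finite F"
  shows "(norm (\<Sum>n\<in>F. c n *\<^sub>C g n))\<^sup>2 \<le> B * (\<Sum>n\<in>F. (cmod (c n))\<^sup>2)"
proof -
  define x where "x = (\<Sum>n\<in>F. c n *\<^sub>C g n)"
  have "(norm x)\<^sup>2 = cmod (cinner x x)"
    by (simp add: cinner_self norm_power)
  also have "cinner x x = (\<Sum>n\<in>F. c n * cinner (g n) x)"
    by (subst x_def, subst linear_sum[OF bounded_linear.linear[OF bounded_linear_cinner_left]])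
      (simp add: cinner_scaleC_left)
  also have "cmod \<dots> \<le> (\<Sum>n\<in>F. \<bar>cmod (c n)\<bar> * \<bar>cmod (cinner x (g n))\<bar>)"
    by (intro order_trans[OF norm_sum] sum_mono)
      (simp add: norm_mult cmod_cinner_commute[of x])
  also have "\<dots> \<le> L2_set (\<lambda>n. cmod (c n)) F * L2_set (\<lambda>n. cmod (cinner x (g n))) F"
    by (rule L2_set_mult_ineq)
  also have "L2_set (\<lambda>n. cmod (cinner x (g n))) F \<le> sqrt B * norm x"
  proof -
    have "(\<Sum>n\<in>F. (cmod (cinner x (g n)))\<^sup>2) \<le> B * (norm x)\<^sup>2"
      using sum_le_suminf[OF summable_coeffs[of x] assms] upper[of x] by simp
    then have "sqrt (\<Sum>n\<in>F. (cmod (cinner x (g n)))\<^sup>2) \<le> sqrt (B * (norm x)\<^sup>2)"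
      by (rule real_sqrt_le_mono)
    then show ?thesis
      by (simp add: L2_set_def real_sqrt_mult)
  qed
  finally have *: "(norm x)\<^sup>2 \<le> L2_set (\<lambda>n. cmod (c n)) F * (sqrt B * norm x)"
    by (simp add: mult_left_mono)
  have "norm x \<le> L2_set (\<lambda>n. cmod (c n)) F * sqrt B"
  proof (cases "x = 0")
    case False
    with * show ?thesis
      by (simp add: power2_eq_square mult.assoc[symmetric])
  qed (simp add: B_nonneg)
  then have "(norm x)\<^sup>2 \<le> (L2_set (\<lambda>n. cmod (c n)) F * sqrt B)\<^sup>2"
    by (rule power_mono) simp
  then show ?thesis
    using B_nonneg by (simp add: x_def L2_set_def power_mult_distrib sum_nonneg mult.commute)
qed

lemma summable_synthesis:
  assumes c: "summable (\<lambda>n. (cmod (c n))\<^sup>2)"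
  shows "summable (\<lambda>n. c n *\<^sub>C g n)"
  unfolding summable_Cauchy
proof (intro allI impI)
  fix e :: real assume e: "e > 0"
  \<comment> \<open>\<open>B + 1\<close> instead of \<open>B\<close>, so that the division is by a number known to be positive.\<close>
  have "B + 1 > 0"
    using B_nonneg by simp
  with e have "e\<^sup>2 / (B + 1) > 0"
    by simp
  then obtain N where N: "\<And>m n. m \<ge> N \<Longrightarrow> norm (\<Sum>k=m..<n. (cmod (c k))\<^sup>2) < e\<^sup>2 / (B + 1)"
    using c unfolding summable_Cauchy by meson
  have "norm (\<Sum>k=m..<n. c k *\<^sub>C g k) < e" if "m \<ge> N" for m n
  proof -
    have "(norm (\<Sum>k=m..<n. c k *\<^sub>C g k))\<^sup>2 \<le> B * (\<Sum>k=m..<n. (cmod (c k))\<^sup>2)"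
      by (rule norm_finite_synthesis_le) simp
    also have "\<dots> \<le> (B + 1) * (\<Sum>k=m..<n. (cmod (c k))\<^sup>2)"
      by (intro mult_right_mono sum_nonneg) auto
    also have "\<dots> < e\<^sup>2"
      using N[OF that, of n] \<open>B + 1 > 0\<close> by (simp add: sum_nonneg field_simps)
    finally show ?thesis
      using power_less_imp_less_base[of _ 2 e] e by simp
  qed
  then show "\<exists>N. \<forall>m\<ge>N. \<forall>n. norm (\<Sum>k=m..<n. c k *\<^sub>C g k) < e"
    by blast
qed

lemma norm_synthesis_le:
  assumes c: "summable (\<lambda>n. (cmod (c n))\<^sup>2)"
  shows "(norm (\<Sum>n. c n *\<^sub>C g n))\<^sup>2 \<le> B * (\<Sum>n. (cmod (c n))\<^sup>2)"
proof (rule LIMSEQ_le_const2)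
  show "(\<lambda>N. (norm (\<Sum>n<N. c n *\<^sub>C g n))\<^sup>2) \<longlonglongrightarrow> (norm (\<Sum>n. c n *\<^sub>C g n))\<^sup>2"
    by (intro tendsto_intros summable_LIMSEQ summable_synthesis c)
  show "\<exists>N. \<forall>M\<ge>N. (norm (\<Sum>n<M. c n *\<^sub>C g n))\<^sup>2 \<le> B * (\<Sum>n. (cmod (c n))\<^sup>2)"
    by (intro exI allI impI order_trans[OF norm_finite_synthesis_le] mult_left_mono B_nonneg
        sum_le_suminf c) auto
qed

definition frame_operator :: "'a \<Rightarrow> 'a"
  where "frame_operator f = (\<Sum>n. cinner f (g n) *\<^sub>C g n)"

lemma summable_frame_operator: "summable (\<lambda>n. cinner f (g n) *\<^sub>C g n)"
  by (rule summable_synthesis) (rule summable_coeffs)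

lemma sums_frame_operator: "(\<lambda>n. cinner f (g n) *\<^sub>C g n) sums frame_operator f"
  unfolding frame_operator_def using summable_frame_operator by (rule summable_sums)

lemma sums_cinner_frame_operator:
  "(\<lambda>n. cinner f (g n) * cinner (g n) h) sums cinner (frame_operator f) h"
  using bounded_linear.sums[OF bounded_linear_cinner_left sums_frame_operator]
  by (simp add: cinner_scaleC_left)

lemma bounded_clinear_frame_operator: "bounded_clinear frame_operator"
proof (rule bounded_clinearI)
  show "frame_operator (x + y) = frame_operator x + frame_operator y" for x y
    using sums_add[OF sums_frame_operator[of x] sums_frame_operator[of y]]
    by (intro sums_unique2[OF sums_frame_operator])
      (simp add: cinner_add_left scaleC_add_left)
  show "frame_operator (c *\<^sub>C x) = c *\<^sub>C frame_operator x" for c x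
    using bounded_linear.sums[OF bounded_linear_scaleC sums_frame_operator, of c x]
    by (intro sums_unique2[OF sums_frame_operator])
      (simp add: cinner_scaleC_left scaleC_scaleC)
  show "norm (frame_operator f) \<le> norm f * B" for f
  proof (rule power2_le_imp_le)
    have "(norm (frame_operator f))\<^sup>2 \<le> B * (\<Sum>n. (cmod (cinner f (g n)))\<^sup>2)"
      unfolding frame_operator_def by (rule norm_synthesis_le) (rule summable_coeffs)
    also have "\<dots> \<le> B * (B * (norm f)\<^sup>2)"
      by (intro mult_left_mono upper B_nonneg)
    finally show "(norm (frame_operator f))\<^sup>2 \<le> (norm f * B)\<^sup>2"
      by (simp add: power2_eq_square mult_ac)
  qed (simp add: B_nonneg)
qed

lemma frame_operator_self_adjoint: "is_adjoint frame_operator frame_operator"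
  unfolding is_adjoint_def
proof (intro allI)
  fix f h
  have "(\<lambda>n. cnj (cinner h (g n) * cinner (g n) f)) sums cnj (cinner (frame_operator h) f)"
    unfolding sums_cnj by (rule sums_cinner_frame_operator)
  then have "(\<lambda>n. cinner f (g n) * cinner (g n) h) sums cinner f (frame_operator h)"
    by (simp add: cinner_commute[symmetric] mult.commute)
  then show "cinner (frame_operator f) h = cinner f (frame_operator h)"
    by (rule sums_unique2[OF sums_cinner_frame_operator])
qed

lemma invertible_frame_operator: "invertible_operator frame_operator"
proof (rule invertible_operator_coercive[OF bounded_clinear_frame_operator A_pos])
  fix f
  have "(\<lambda>n. Re (cinner f (g n) * cinner (g n) f)) sums Re (cinner (frame_operator f) f)"
    by (rule sums_Re) (rule sums_cinner_frame_operator)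
  then have "(\<Sum>n. (cmod (cinner f (g n)))\<^sup>2) = Re (cinner (frame_operator f) f)"
    by (simp add: cinner_mult_commute sums_iff del: of_real_power)
  with lower[of f] show "A * (norm f)\<^sup>2 \<le> Re (cinner (frame_operator f) f)"
    by simp
qed

text \<open>
  With \<open>T\<^sup>*\<close> at hand this would be the upper frame bound at \<open>T\<^sup>* y\<close>, but the construction of \<open>T\<^sup>*\<close> relies
  on it. Instead a partial sum \<open>s\<close> is written as \<open>\<langle>T x, y\<rangle>\<close> with \<open>x\<close> a finite combination of the
  \<open>g\<^sub>n\<close>; the bound on \<open>\<parallel>x\<parallel>\<^sup>2\<close> by \<open>B s\<close> then yields \<open>s\<^sup>2 \<le> const * s\<close>.
\<close>

lemma summable_image_coeffs:
  assumes T: "bounded_clinear T"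
  shows "summable (\<lambda>n. (cmod (cinner y (T (g n))))\<^sup>2)"
proof -
  obtain K where K: "K > 0" "\<And>x. norm (T x) \<le> norm x * K"
    using bounded_linear.pos_bounded[OF bounded_clinear_bounded_linear[OF T]] by blast
  have lin: "linear T"
    using T by (simp add: bounded_clinear_def bounded_linear.linear)
  show ?thesis
  proof (rule bounded_imp_summable)
    fix N
    define c where "c n = cinner y (T (g n))" for n
    define s where "s = (\<Sum>n\<le>N. (cmod (c n))\<^sup>2)"
    have s: "s \<ge> 0"
      by (simp add: s_def sum_nonneg)
    have "complex_of_real s = cinner (\<Sum>n\<le>N. T (c n *\<^sub>C g n)) y"
      unfolding linear_sum[OF bounded_linear.linear[OF bounded_linear_cinner_left]] s_def
      by (simp add: bounded_clinear_scaleC[OF T] cinner_scaleC_left cinner_mult_commute c_def)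
    also have "\<dots> = cinner (T (\<Sum>n\<le>N. c n *\<^sub>C g n)) y"
      by (simp add: linear_sum[OF lin])
    finally have "s \<le> norm (T (\<Sum>n\<le>N. c n *\<^sub>C g n)) * norm y"
      using s cinner_Cauchy_Schwarz[of "T (\<Sum>n\<le>N. c n *\<^sub>C g n)" y]
      by (metis abs_of_nonneg norm_of_real)
    also have "\<dots> \<le> norm (\<Sum>n\<le>N. c n *\<^sub>C g n) * K * norm y"
      by (intro mult_right_mono K) simp
    finally have "s\<^sup>2 \<le> (norm (\<Sum>n\<le>N. c n *\<^sub>C g n) * K * norm y)\<^sup>2"
      using s by (rule power_mono)
    also have "\<dots> = (norm (\<Sum>n\<le>N. c n *\<^sub>C g n))\<^sup>2 * (K * norm y)\<^sup>2"
      by (simp add: power_mult_distrib)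
    also have "\<dots> \<le> B * s * (K * norm y)\<^sup>2"
      unfolding s_def by (intro mult_right_mono norm_finite_synthesis_le) auto
    finally have "s * s \<le> s * (B * (K * norm y)\<^sup>2)"
      by (simp add: power2_eq_square mult_ac)
    then show "(\<Sum>n\<le>N. (cmod (cinner y (T (g n))))\<^sup>2) \<le> B * (K * norm y)\<^sup>2"
      using s B_nonneg by (cases "s = 0") (auto simp: s_def c_def)
  qed simp
qed

text \<open>
  Expanding \<open>x = S w = \<Sum> \<langle>w, g\<^sub>n\<rangle> g\<^sub>n\<close> gives \<open>\<langle>T x, y\<rangle> = \<Sum> \<langle>w, g\<^sub>n\<rangle> \<langle>T g\<^sub>n, y\<rangle> = \<langle>w, z\<rangle>\<close> with
  \<open>z = \<Sum> \<langle>y, T g\<^sub>n\<rangle> g\<^sub>n\<close>, and \<open>\<langle>w, z\<rangle> = \<langle>x, S\<^sup>-\<^sup>1 z\<rangle>\<close> by self-adjointness of \<open>S\<close>.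
\<close>

lemma adjoint_exists:
  fixes T :: "'a \<Rightarrow> 'a"
  assumes T: "bounded_clinear T"
  shows "\<exists>T'. is_adjoint T T'"
proof -
  define S where "S = frame_operator"
  have S: "S (inv S x) = x" for x
    using invertible_frame_operator
    by (simp add: S_def invertible_operator_def bij_is_surj surj_f_inv_f)
  have S_adj: "cinner (S x) y = cinner x (S y)" for x y
    using frame_operator_self_adjoint by (simp add: S_def is_adjoint_def)
  define z where "z y = (\<Sum>n. cinner y (T (g n)) *\<^sub>C g n)" for y
  have "cinner (T x) y = cinner x (inv S (z y))" for x y
  proof -
    define w where "w = inv S x"
    have x: "x = S w"
      by (simp add: w_def S)
    have "(\<lambda>n. cinner w (g n) *\<^sub>C T (g n)) sums T x"
      using bounded_linear.sums[OF bounded_clinear_bounded_linear[OF T] sums_frame_operator[of w]]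
      by (simp add: bounded_clinear_scaleC[OF T] x S_def)
    then have 1: "(\<lambda>n. cinner w (g n) * cinner (T (g n)) y) sums cinner (T x) y"
      using bounded_linear.sums[OF bounded_linear_cinner_left] by (fastforce simp: cinner_scaleC_left)
    have "(\<lambda>n. cinner y (T (g n)) *\<^sub>C g n) sums z y"
      unfolding z_def by (intro summable_sums summable_synthesis summable_image_coeffs T)
    from bounded_linear.sums[OF bounded_linear_cinner_right this, of w]
    have 2: "(\<lambda>n. cinner w (g n) * cinner (T (g n)) y) sums cinner w (z y)"
      by (simp add: cinner_scaleC_right cinner_commute[symmetric] mult.commute)
    have "cinner (T x) y = cinner w (S (inv S (z y)))"
      using 1 2 by (simp add: S sums_unique2)
    then show ?thesis
      by (simp add: x S_adj)
  qed
  then show ?thesis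
    unfolding is_adjoint_def by (intro exI[of _ "\<lambda>y. inv S (z y)"]) simp
qed

lemma hilbert_frame_weighted:
  assumes "0 < a" and w: "\<And>n. a \<le> w n" "\<And>n. w n \<le> b"
  shows "hilbert_frame (\<lambda>n. w n *\<^sub>R g n) (a\<^sup>2 * A) (b\<^sup>2 * B)"
proof
  have w0: "0 \<le> w n" for n
    using w(1)[of n] assms(1) by simp
  have "a \<le> b"
    using w[of 0] by simp
  then show "0 < a\<^sup>2 * A" "a\<^sup>2 * A \<le> b\<^sup>2 * B"
    using assms(1) A_pos A_le_B by (auto intro!: mult_mono power_mono)
  fix f
  let ?c = "\<lambda>n. (cmod (cinner f (g n)))\<^sup>2"
  have eq: "(cmod (cinner f (w n *\<^sub>R g n)))\<^sup>2 = (w n)\<^sup>2 * ?c n" for n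
    by (simp add: cinner_scaleR_right norm_mult power_mult_distrib)
  have le: "a\<^sup>2 * ?c n \<le> (w n)\<^sup>2 * ?c n" "(w n)\<^sup>2 * ?c n \<le> b\<^sup>2 * ?c n" for n
    using w assms(1) w0 by (auto intro!: mult_right_mono power_mono)
  have sm: "summable (\<lambda>n. (w n)\<^sup>2 * ?c n)"
    by (rule summable_comparison_test'[OF summable_mult[OF summable_coeffs[of f], of "b\<^sup>2"], of 0])
      (use le in auto)
  then show "summable (\<lambda>n. (cmod (cinner f (w n *\<^sub>R g n)))\<^sup>2)"
    by (simp add: eq)
  have "a\<^sup>2 * A * (norm f)\<^sup>2 \<le> a\<^sup>2 * (\<Sum>n. ?c n)"
    using lower[of f] by (simp add: mult.assoc mult_left_mono)
  also have "\<dots> \<le> (\<Sum>n. (w n)\<^sup>2 * ?c n)"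
    unfolding suminf_mult[OF summable_coeffs, symmetric]
    by (intro suminf_le le sm summable_mult summable_coeffs)
  finally show "a\<^sup>2 * A * (norm f)\<^sup>2 \<le> (\<Sum>n. (cmod (cinner f (w n *\<^sub>R g n)))\<^sup>2)"
    by (simp add: eq)
  have "(\<Sum>n. (w n)\<^sup>2 * ?c n) \<le> b\<^sup>2 * (\<Sum>n. ?c n)"
    unfolding suminf_mult[OF summable_coeffs, symmetric]
    by (intro suminf_le le sm summable_mult summable_coeffs)
  also have "\<dots> \<le> b\<^sup>2 * B * (norm f)\<^sup>2"
    using upper[of f] by (simp add: mult.assoc mult_left_mono)
  finally show "(\<Sum>n. (cmod (cinner f (w n *\<^sub>R g n)))\<^sup>2) \<le> b\<^sup>2 * B * (norm f)\<^sup>2"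
    by (simp add: eq)
qed

text \<open>
  The coefficients of \<open>f\<close> with respect to \<open>U g\<^sub>n\<close> are those of \<open>U\<^sup>* f\<close> with respect to \<open>g\<^sub>n\<close>, and
  \<open>\<parallel>U\<^sup>* f\<parallel>\<close> is comparable to \<open>\<parallel>f\<parallel>\<close>.
\<close>

lemma hilbert_frame_image:
  assumes U': "invertible_operator U'" and adj: "is_adjoint U U'"
  shows "\<exists>A' B'. hilbert_frame (\<lambda>n. U (g n)) A' B'"
proof -
  have bl: "bounded_linear U'" "bounded_linear (inv U')" and bij: "bij U'"
    using U' by (auto simp: invertible_operator_def bounded_clinear_def)
  obtain K where K: "K > 0" "\<And>x. norm (U' x) \<le> norm x * K"
    using bounded_linear.pos_bounded[OF bl(1)] by blast
  obtain L where L: "L > 0" "\<And>x. norm (inv U' x) \<le> norm x * L"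
    using bounded_linear.pos_bounded[OF bl(2)] by blast
  have coeff: "cinner f (U (g n)) = cinner (U' f) (g n)" for f n
    using adj by (metis is_adjoint_def cinner_commute)
  have low: "(norm f)\<^sup>2 / L\<^sup>2 \<le> (norm (U' f))\<^sup>2" for f
  proof -
    have "norm f \<le> norm (U' f) * L"
      using L(2)[of "U' f"] bij by (simp add: bij_is_inj)
    then have "(norm f)\<^sup>2 \<le> (norm (U' f) * L)\<^sup>2"
      by (rule power_mono) simp
    then show ?thesis
      using L(1) by (simp add: power_mult_distrib field_simps)
  qed
  have up: "(norm (U' f))\<^sup>2 \<le> K\<^sup>2 * (norm f)\<^sup>2" for f
    using power_mono[OF K(2)[of f], of 2] by (simp add: power_mult_distrib mult.commute)
  \<comment> \<open>On the zero space \<open>K\<close> and \<open>L\<close> are unrelated, so the bounds are ordered by taking a maximum.\<close>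
  have "hilbert_frame (\<lambda>n. U (g n)) (A / L\<^sup>2) (max (A / L\<^sup>2) (B * K\<^sup>2))"
  proof
    show "0 < A / L\<^sup>2"
      using A_pos L(1) by simp
    fix f
    show "summable (\<lambda>n. (cmod (cinner f (U (g n))))\<^sup>2)"
      unfolding coeff by (rule summable_coeffs)
    have "A / L\<^sup>2 * (norm f)\<^sup>2 \<le> A * (norm (U' f))\<^sup>2"
      using mult_left_mono[OF low[of f], of A] A_pos by simp
    with lower[of "U' f"] show "A / L\<^sup>2 * (norm f)\<^sup>2 \<le> (\<Sum>n. (cmod (cinner f (U (g n))))\<^sup>2)"
      unfolding coeff by simp
    have "B * (norm (U' f))\<^sup>2 \<le> B * K\<^sup>2 * (norm f)\<^sup>2"
      using mult_left_mono[OF up[of f] B_nonneg] by simp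
    also have "\<dots> \<le> max (A / L\<^sup>2) (B * K\<^sup>2) * (norm f)\<^sup>2"
      by (intro mult_right_mono) auto
    finally show "(\<Sum>n. (cmod (cinner f (U (g n))))\<^sup>2)
        \<le> max (A / L\<^sup>2) (B * K\<^sup>2) * (norm f)\<^sup>2"
      using upper[of "U' f"] unfolding coeff by simp
  qed simp
  then show ?thesis
    by blast
qed

end

section \<open>Sequences transformed by an infinite matrix, and multipliers\<close>

lemma is_E_frame_iff:
  "is_E_frame E \<psi> \<longleftrightarrow> (\<forall>n. summable (\<lambda>k. E n k *\<^sub>C \<psi> k)) \<and>
    (\<exists>A B. hilbert_frame (matrix_seq E \<psi>) A B)"
  unfolding is_E_frame_def hilbert_frame_def by (auto simp: all_conj_distrib)

lemma matrix_seq_image: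
  assumes U: "bounded_clinear U" and conv: "summable (\<lambda>k. E n k *\<^sub>C \<phi> k)"
  shows "summable (\<lambda>k. E n k *\<^sub>C U (\<phi> k))"
    and "matrix_seq E (\<lambda>k. U (\<phi> k)) n = U (matrix_seq E \<phi> n)"
proof -
  have "(\<lambda>k. E n k *\<^sub>C U (\<phi> k)) sums U (matrix_seq E \<phi> n)"
    using bounded_linear.sums[OF bounded_clinear_bounded_linear[OF U] summable_sums[OF conv]]
    by (simp add: bounded_clinear_scaleC[OF U] matrix_seq_def)
  then show "summable (\<lambda>k. E n k *\<^sub>C U (\<phi> k))"
    and "matrix_seq E (\<lambda>k. U (\<phi> k)) n = U (matrix_seq E \<phi> n)"
    by (simp_all add: sums_iff matrix_seq_def[of E "\<lambda>k. U (\<phi> k)"])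
qed

text \<open>
  In the series for row \<open>n\<close> only the indices with \<open>E\<^sub>n\<^sub>k \<noteq> 0\<close> contribute, and there the weight has
  the value \<open>w\<^sub>n\<close>, which can be taken out.
\<close>

lemma matrix_seq_weighted:
  fixes \<phi> :: "nat \<Rightarrow> 'a::complex_inner"
  assumes commute: "\<And>k. E n k \<noteq> 0 \<Longrightarrow> w k = w n" and conv: "summable (\<lambda>k. E n k *\<^sub>C \<phi> k)"
  shows "summable (\<lambda>k. E n k *\<^sub>C (w k *\<^sub>R \<phi> k))"
    and "matrix_seq E (\<lambda>k. w k *\<^sub>R \<phi> k) n = w n *\<^sub>R matrix_seq E \<phi> n"
proof -
  have "E n k *\<^sub>C (w k *\<^sub>R \<phi> k) = w n *\<^sub>R (E n k *\<^sub>C \<phi> k)" for k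
    using commute[of k] by (cases "E n k = 0") (auto simp: scaleR_scaleC scaleC_scaleC mult.commute)
  then have "(\<lambda>k. E n k *\<^sub>C (w k *\<^sub>R \<phi> k)) sums (w n *\<^sub>R matrix_seq E \<phi> n)"
    using sums_scaleR_right[OF summable_sums[OF conv], of "w n"] by (simp add: matrix_seq_def)
  then show "summable (\<lambda>k. E n k *\<^sub>C (w k *\<^sub>R \<phi> k))"
    and "matrix_seq E (\<lambda>k. w k *\<^sub>R \<phi> k) n = w n *\<^sub>R matrix_seq E \<phi> n"
    by (simp_all add: sums_iff matrix_seq_def[of E "\<lambda>k. w k *\<^sub>R \<phi> k"])
qed

text \<open>
  Half of the weight \<open>m\<^sub>n = \<epsilon> w\<^sub>n\<^sup>2\<close> is put into the analysis and half into the synthesis, which makes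
  the multiplier a frame operator up to the constant \<open>\<epsilon>\<close>; the operator \<open>U\<close> passes to \<open>f\<close> as \<open>U\<^sup>*\<close>
  on the analysis side and out of the series on the synthesis side.
\<close>

lemma sums_weighted_multiplier:
  fixes g :: "nat \<Rightarrow> 'a::chilbert_space"
  assumes frame: "hilbert_frame (\<lambda>n. w n *\<^sub>R g n) A B" and m: "\<And>n. m n = \<epsilon> * (w n)\<^sup>2"
    and U: "bounded_clinear U" "is_adjoint U U'"
  defines "S \<equiv> hilbert_frame.frame_operator (\<lambda>n. w n *\<^sub>R g n)"
  shows "(\<lambda>n. (complex_of_real (m n) * cinner f (U (g n))) *\<^sub>C g n) sums (\<epsilon> *\<^sub>R S (U' f))"
    and "(\<lambda>n. (complex_of_real (m n) * cinner f (g n)) *\<^sub>C U (g n)) sums (\<epsilon> *\<^sub>R U (S f))"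
proof -
  interpret hilbert_frame "\<lambda>n. w n *\<^sub>R g n" A B
    by (rule frame)
  have adj: "cinner f (U (g n)) = cinner (U' f) (g n)" for f n
    using U(2) by (metis is_adjoint_def cinner_commute)
  have eq: "\<epsilon> *\<^sub>R (cinner f (w n *\<^sub>R g n) *\<^sub>C (w n *\<^sub>R g n))
      = (complex_of_real (m n) * cinner f (g n)) *\<^sub>C g n" for f n
    by (simp add: m scaleR_scaleC scaleC_scaleC cinner_scaleC_right power2_eq_square mult_ac)
  have S: "(\<lambda>n. (complex_of_real (m n) * cinner f (g n)) *\<^sub>C g n) sums (\<epsilon> *\<^sub>R S f)" for f
    using sums_scaleR_right[OF sums_frame_operator[of f], of \<epsilon>] unfolding eq S_def .
  show "(\<lambda>n. (complex_of_real (m n) * cinner f (U (g n))) *\<^sub>C g n) sums (\<epsilon> *\<^sub>R S (U' f))"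
    unfolding adj by (rule S)
  show "(\<lambda>n. (complex_of_real (m n) * cinner f (g n)) *\<^sub>C U (g n)) sums (\<epsilon> *\<^sub>R U (S f))"
    using bounded_linear.sums[OF bounded_clinear_bounded_linear[OF U(1)] S[of f]] U(1)
    by (simp add: bounded_clinear_scaleC[OF U(1)] linear_scale[OF bounded_linear.linear]
        bounded_clinear_bounded_linear)
qed

theorem theorem2p2p11:
  fixes E :: infinite_matrix
    and m :: "nat \<Rightarrow> real"
    and \<phi> \<psi> :: "nat \<Rightarrow> 'a::chilbert_space"
    and U :: "'a \<Rightarrow> 'a"
  assumes separable: "separable_space (euclidean :: 'a topology)"
    and E_invertible: "invertible_infinite_matrix E"
    and sign: "(\<forall>k. m k > 0) \<or> (\<forall>k. m k < 0)"
    and semi: "semi_normalized m"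
    and commute: "\<And>n k. complex_of_real (m n) * E n k = E n k * complex_of_real (m k)"
    and frame: "is_E_frame E \<phi>"
    and U: "bounded_clinear U" "bij U"
    and psi: "\<And>k. \<psi> k = U (\<phi> k)"
  shows "is_E_frame E \<psi> \<and>
    is_E_frame E (\<lambda>k. sqrt \<bar>m k\<bar> *\<^sub>R \<phi> k) \<and>
    E_frame_operator_converges E (\<lambda>k. sqrt \<bar>m k\<bar> *\<^sub>R \<phi> k) \<and>
    invertible_operator (E_frame_operator E (\<lambda>k. sqrt \<bar>m k\<bar> *\<^sub>R \<phi> k)) \<and>
    E_multiplier_converges E (\<lambda>n. complex_of_real (m n)) \<phi> \<psi> \<and>
    invertible_operator (E_multiplier E (\<lambda>n. complex_of_real (m n)) \<phi> \<psi>) \<and>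
    E_multiplier_converges E (\<lambda>n. complex_of_real (m n)) \<psi> \<phi> \<and>
    invertible_operator (E_multiplier E (\<lambda>n. complex_of_real (m n)) \<psi> \<phi>) \<and>
    ((\<forall>k. m k > 0) \<longrightarrow>
        inv (E_multiplier E (\<lambda>n. complex_of_real (m n)) \<phi> \<psi>) =
          cadjoint (inv U) \<circ> inv (E_frame_operator E (\<lambda>k. sqrt (m k) *\<^sub>R \<phi> k))) \<and>
    ((\<forall>k. m k < 0) \<longrightarrow>
        inv (E_multiplier E (\<lambda>n. complex_of_real (m n)) \<phi> \<psi>) =
          (\<lambda>f. - (cadjoint (inv U) \<circ> inv (E_frame_operator E (\<lambda>k. sqrt \<bar>m k\<bar> *\<^sub>R \<phi> k))) f)) \<and>
    ((\<forall>k. m k > 0) \<longrightarrow>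
        inv (E_multiplier E (\<lambda>n. complex_of_real (m n)) \<psi> \<phi>) =
          inv (E_frame_operator E (\<lambda>k. sqrt (m k) *\<^sub>R \<phi> k)) \<circ> inv U) \<and>
    ((\<forall>k. m k < 0) \<longrightarrow>
        inv (E_multiplier E (\<lambda>n. complex_of_real (m n)) \<psi> \<phi>) =
          (\<lambda>f. - (inv (E_frame_operator E (\<lambda>k. sqrt \<bar>m k\<bar> *\<^sub>R \<phi> k)) \<circ> inv U) f))"
proof -
  define g where "g = matrix_seq E \<phi>"
  define w where "w k = sqrt \<bar>m k\<bar>" for k
  define \<epsilon> where "\<epsilon> = sgn (m 0)"
  have m: "m k = \<epsilon> * (w k)\<^sup>2" for k
    using sign by (auto simp: \<epsilon>_def w_def abs_of_pos abs_of_neg)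

  from frame obtain A B where conv: "\<And>n. summable (\<lambda>k. E n k *\<^sub>C \<phi> k)"
    and "hilbert_frame g A B"
    unfolding is_E_frame_iff g_def by blast
  then interpret hilbert_frame g A B
    by simp

  have w_const: "w k = w n" if "E n k \<noteq> 0" for n k
    using commute[of n k] that by (simp add: w_def mult.commute)
  note weighted = matrix_seq_weighted[where E = E and w = w and \<phi> = \<phi>, OF w_const conv]
  have seq_weighted: "matrix_seq E (\<lambda>k. w k *\<^sub>R \<phi> k) = (\<lambda>n. w n *\<^sub>R g n)"
    using weighted(2) by (auto simp: g_def)
  define a where "a = (INF n. \<bar>m n\<bar>)"
  define b where "b = (SUP n. \<bar>m n\<bar>)"
  have a: "0 < a" "a \<le> \<bar>m n\<bar>" and b: "\<bar>m n\<bar> \<le> b" for n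
    using semi unfolding semi_normalized_def a_def b_def
    by (auto intro!: cINF_lower cSUP_upper bdd_belowI[where m = 0])
  have frame_w: "hilbert_frame (\<lambda>n. w n *\<^sub>R g n) ((sqrt a)\<^sup>2 * A) ((sqrt b)\<^sup>2 * B)"
    using a b by (intro hilbert_frame_weighted) (auto simp: w_def)
  then interpret W: hilbert_frame "\<lambda>n. w n *\<^sub>R g n" "(sqrt a)\<^sup>2 * A" "(sqrt b)\<^sup>2 * B" .
  define S where "S = W.frame_operator"
  have S: "E_frame_operator E (\<lambda>k. w k *\<^sub>R \<phi> k) = S"
    by (simp add: fun_eq_iff E_frame_operator_def S_def W.frame_operator_def seq_weighted)
  have inv_S: "invertible_operator S"
    unfolding S_def by (rule W.invertible_frame_operator)
  have frame_weighted: "is_E_frame E (\<lambda>k. w k *\<^sub>R \<phi> k)"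
    unfolding is_E_frame_iff seq_weighted using weighted(1) frame_w by blast
  have conv_S: "E_frame_operator_converges E (\<lambda>k. w k *\<^sub>R \<phi> k)"
    unfolding E_frame_operator_converges_def seq_weighted
    using W.summable_frame_operator by blast

  obtain U' where adj: "is_adjoint U U'"
    using adjoint_exists[OF U(1)] by blast
  have inv_U: "invertible_operator U"
    using U adj by (rule invertible_operatorI_bij)
  then obtain V' where adj_inv: "is_adjoint (inv U) V'"
    using adjoint_exists unfolding invertible_operator_def by blast
  note inv_U' = invertible_operator_adjoint[OF inv_U adj adj_inv]
  have inv_U'_eq: "inv U' = cadjoint (inv U)"
    using inv_U'(2) cadjoint_eqI[OF adj_inv] by simp

  have psi': "\<psi> = (\<lambda>k. U (\<phi> k))"
    using psi by auto
  have seq_psi: "matrix_seq E \<psi> = (\<lambda>n. U (g n))"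
    unfolding psi' g_def using matrix_seq_image(2)[OF U(1) conv] by auto
  have frame_psi: "is_E_frame E \<psi>"
    unfolding is_E_frame_iff seq_psi
    using hilbert_frame_image[OF inv_U'(1) adj] matrix_seq_image(1)[OF U(1) conv]
    by (auto simp: psi')

  define M1 where "M1 = E_multiplier E (\<lambda>n. complex_of_real (m n)) \<phi> \<psi>"
  define M2 where "M2 = E_multiplier E (\<lambda>n. complex_of_real (m n)) \<psi> \<phi>"
  note mult = sums_weighted_multiplier[where m = m, OF frame_w m U(1) adj, folded S_def]
  have conv1: "E_multiplier_converges E (\<lambda>n. complex_of_real (m n)) \<phi> \<psi>"
    and conv2: "E_multiplier_converges E (\<lambda>n. complex_of_real (m n)) \<psi> \<phi>"
    unfolding E_multiplier_converges_def seq_psi g_def[symmetric]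
    using mult by (auto intro: sums_summable)
  have M1: "M1 = (\<lambda>f. \<epsilon> *\<^sub>R (S \<circ> U') f)" and M2: "M2 = (\<lambda>f. \<epsilon> *\<^sub>R (U \<circ> S) f)"
    unfolding M1_def M2_def fun_eq_iff E_multiplier_def seq_psi g_def[symmetric]
    using mult by (simp_all add: sums_unique[symmetric])

  have bij: "bij S" "bij U" "bij U'"
    using inv_S inv_U inv_U'(1) by (auto simp: invertible_operator_def)
  have inv_comp: "invertible_operator (S \<circ> U')" "invertible_operator (U \<circ> S)"
    using inv_S inv_U inv_U'(1) by (auto intro: invertible_operator_compose)
  have inv_eq: "inv (S \<circ> U') = cadjoint (inv U) \<circ> inv S" "inv (U \<circ> S) = inv S \<circ> inv U"
    using bij by (simp_all add: o_inv_distrib inv_U'_eq)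

  have pos: "M1 = S \<circ> U'" "M2 = U \<circ> S" if "\<forall>k. m k > 0"
    using that by (simp_all add: M1 M2 \<epsilon>_def fun_eq_iff)
  have neg: "M1 = (\<lambda>f. - (S \<circ> U') f)" "M2 = (\<lambda>f. - (U \<circ> S) f)" if "\<forall>k. m k < 0"
    using that by (simp_all add: M1 M2 \<epsilon>_def fun_eq_iff)
  have inv_M: "invertible_operator M1" "invertible_operator M2"
    using sign pos neg inv_comp invertible_operator_uminus(1)[OF inv_comp(1)]
      invertible_operator_uminus(1)[OF inv_comp(2)] by auto
  have inv_pos: "inv M1 = cadjoint (inv U) \<circ> inv S" "inv M2 = inv S \<circ> inv U" if "\<forall>k. m k > 0"
    using pos[OF that] inv_eq by simp_all
  have inv_neg: "inv M1 = (\<lambda>f. - (cadjoint (inv U) \<circ> inv S) f)"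
    "inv M2 = (\<lambda>f. - (inv S \<circ> inv U) f)" if "\<forall>k. m k < 0"
    unfolding neg[OF that] by (simp_all only: invertible_operator_uminus(2)[OF inv_comp(1)]
        invertible_operator_uminus(2)[OF inv_comp(2)] inv_eq)
  have S_pos: "E_frame_operator E (\<lambda>k. sqrt (m k) *\<^sub>R \<phi> k) = S" if "\<forall>k. m k > 0"
    using that S by (simp add: w_def abs_of_pos)
  show ?thesis
    using frame_psi frame_weighted conv_S inv_S conv1 conv2 inv_M inv_pos inv_neg S_pos
    unfolding S[symmetric] M1_def M2_def w_def by simp
qed

end
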